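(* Let $\pi=r_1\ldots r_k$ be a fixed sequence of nonnegative integers, not all zero, whose largest term is $r$. Then, as $n\to\infty$, $$\mathbb{P}\big[\mathbf{C}_{n,p}\text{ contains the (nonconsecutive) exact pattern }\pi\big]\to\begin{cases}0,&\text{if } p\ll n^{-1/r},\\ 1,&\text{if } n^{-1/r}\ll p\text{ and } q\gg n^{-1},\\ 0,&\text{if } n^{-1}\gg q.\end{cases}$$
   Context: An $n$-composition is a sequence of $n$ nonnegative integers. For $p=p(n)\in[0,1)$ and $q=1-p$, the geometric random composition $\mathbf{C}_{n,p}$ is the random $n$-composition whose terms are independent, with $\mathbb{P}[\mathbf{C}_{n,p}(i)=j]=qp^j$ for every $j\ge0$ and $i\in\{1,\dots,n\}$. A composition $C$ contains the (nonconsecutive) exact pattern $r_1\ldots r_k$ if there exist indices $i_1<i_2<\dots<i_k$ such that $C(i_j)=r_j$ for each $j\in\{1,\dots,k\}$. For positive functions of $n$: $f\ll g$ (or $g\gg f$) means $\lim_{n\to\infty} f/g=0$. *)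

theory Defs
  imports "HOL-Probability.Probability"
begin

text \<open>
  Since $x / 0 = 0$ in HOL, the denominator must be required to be (eventually) positive
  for the quotient to be meaningful; otherwise every function would be negligible
  with respect to the zero function.
\<close>

definition much_less :: "(nat \<Rightarrow> real) \<Rightarrow> (nat \<Rightarrow> real) \<Rightarrow> bool"  (infix "\<lless>" 50) where
  "f \<lless> g \<longleftrightarrow> (\<forall>\<^sub>F n in sequentially. g n > 0) \<and> (\<lambda>n. f n / g n) \<longlonglongrightarrow> 0"

text \<open>
  An $n$-composition is represented by a function whose terms are its values on \<open>{1..n}\<close>;
  the value outside of that set is fixed to the dummy \<open>0\<close>. The product \<^const>\<open>Pi_pmf\<close> makes the
  terms independent. The parameter of \<^const>\<open>geometric_pmf\<close> is the success
  probability, here \<open>q = 1 - p\<close>.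
\<close>

definition geometric_composition :: "nat \<Rightarrow> real \<Rightarrow> (nat \<Rightarrow> nat) pmf" where
  "geometric_composition n p = Pi_pmf {1..n} 0 (\<lambda>_. geometric_pmf (1 - p))"

lemma prob_geometric_composition_term:
  assumes "0 \<le> p" "p < 1" "i \<in> {1..n}"
  shows "measure_pmf.prob (geometric_composition n p) {C. C i = j} = (1 - p) * p ^ j"
proof -
  have "measure_pmf.prob (geometric_composition n p) {C. C i = j} =
          pmf (map_pmf (\<lambda>C. C i) (geometric_composition n p)) j"
    by (simp add: pmf_map vimage_def)
  also have "map_pmf (\<lambda>C. C i) (geometric_composition n p) = geometric_pmf (1 - p)"
    using assms(3) by (simp add: geometric_composition_def Pi_pmf_component)
  finally show ?thesis
    using assms by (simp add: mult.commute)
qed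

lemma indep_vars_geometric_composition:
  "prob_space.indep_vars (measure_pmf (geometric_composition n p))
     (\<lambda>_. count_space UNIV) (\<lambda>i C. C i) {1..n}"
  unfolding geometric_composition_def by (rule indep_vars_Pi_pmf) simp

text \<open>
  The positions of \<open>C\<close> are numbered from \<open>1\<close> to \<open>n\<close>, whereas those of the list \<open>\<pi>\<close>
  are numbered from \<open>0\<close>.
\<close>

definition contains_exact_pattern :: "nat \<Rightarrow> (nat \<Rightarrow> nat) \<Rightarrow> nat list \<Rightarrow> bool" where
  "contains_exact_pattern n C \<pi> \<longleftrightarrow>
     (\<exists>i. strict_mono_on {..<length \<pi>} i \<and>
          (\<forall>j<length \<pi>. i j \<in> {1..n} \<and> C (i j) = \<pi> ! j))"

end

theory Submission
  imports Defs
begin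

text \<open>
  Up to a constant factor, everything is decided by \<open>n * q * p ^ r\<close>, the expected number of terms
  equal to the largest entry \<open>r\<close> of the pattern.

  A composition that contains the pattern has a term equal to \<open>r\<close>, so \<open>n * q * p ^ r\<close> bounds the
  probability from above (\<open>prob_contains_le\<close>). It tends to \<open>0\<close> in the first case because it is at
  most \<open>n * p ^ r = (p / n powr (- 1 / r)) ^ r\<close> (for \<open>n > 0\<close>), and in the third because it is at most \<open>n * q\<close>.

  For the second case, the positions are cut into one block of \<open>n div k\<close> consecutive positions for
  each of the \<open>k\<close> entries. If every block contains the entry assigned to it, then the positions
  chosen from the successive blocks increase, and the composition contains the pattern. As no entry
  exceeds \<open>r\<close>, each value has probability at least \<open>q * p ^ r\<close> at each position, so a block misses
  its entry with probability at most \<open>exp (- (n div k) * q * p ^ r)\<close>. A union bound over the \<open>k\<close>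
  blocks, with \<open>k\<close> fixed, shows that it suffices that \<open>n * q * p ^ r\<close> tends to infinity. This holds
  because at least one of \<open>p\<close> and \<open>q\<close> is at least \<open>1 / 2\<close> for every \<open>n\<close>, so that
  \<open>n * q * p ^ r\<close> is at least a constant times the smaller of \<open>n * p ^ r\<close> and \<open>n * q\<close>.
\<close>

section \<open>Bounds for a fixed length\<close>

text \<open>
  Any entry of the pattern has to occur somewhere in the composition, so the first moment method
  applies to each entry \<open>v\<close>. The bound is smallest for the largest entry.
\<close>

lemma prob_contains_le:
  assumes p: "0 \<le> p" "p < 1" and v: "v \<in> set \<pi>"
  shows "measure_pmf.prob (geometric_composition n p) {C. contains_exact_pattern n C \<pi>}
           \<le> real n * ((1 - p) * p ^ v)"
proof -
  let ?M = "geometric_composition n p"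
  obtain j where j: "j < length \<pi>" "\<pi> ! j = v"
    using v by (auto simp: in_set_conv_nth)
  have "{C. contains_exact_pattern n C \<pi>} \<subseteq> (\<Union>i\<in>{1..n}. {C. C i = v})"
  proof
    fix C assume "C \<in> {C. contains_exact_pattern n C \<pi>}"
    then obtain i where "\<forall>j<length \<pi>. i j \<in> {1..n} \<and> C (i j) = \<pi> ! j"
      by (auto simp: contains_exact_pattern_def)
    with j show "C \<in> (\<Union>i\<in>{1..n}. {C. C i = v})" by blast
  qed
  then have "measure_pmf.prob ?M {C. contains_exact_pattern n C \<pi>}
      \<le> measure_pmf.prob ?M (\<Union>i\<in>{1..n}. {C. C i = v})"
    by (intro measure_pmf.finite_measure_mono) auto
  also have "\<dots> \<le> (\<Sum>i\<in>{1..n}. measure_pmf.prob ?M {C. C i = v})"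
    by (intro measure_pmf.finite_measure_subadditive_finite) auto
  also have "\<dots> = (\<Sum>i\<in>{1..n}. (1 - p) * p ^ v)"
    using p by (intro sum.cong refl prob_geometric_composition_term)
  finally show ?thesis by simp
qed

lemma prob_avoid_value:
  assumes p: "0 \<le> p" "p < 1" and A: "A \<subseteq> {1..n}"
  shows "measure_pmf.prob (geometric_composition n p) {C. \<forall>i\<in>A. C i \<noteq> v}
           = (1 - (1 - p) * p ^ v) ^ card A"
proof -
  let ?M = "geometric_composition n p"
  let ?B = "\<lambda>i. if i \<in> A then - {v} else UNIV"
  have "{C. \<forall>i\<in>A. C i \<noteq> v} = Pi {1..n} ?B"
    using A by (force simp: Pi_def subset_eq)
  then have "measure_pmf.prob ?M {C. \<forall>i\<in>A. C i \<noteq> v}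
      = (\<Prod>i\<in>{1..n}. measure_pmf.prob (geometric_pmf (1 - p)) (?B i))"
    by (simp only: geometric_composition_def measure_Pi_pmf_Pi finite_atLeastAtMost)
  also have "\<dots> = (\<Prod>i\<in>A. measure_pmf.prob (geometric_pmf (1 - p)) (?B i))"
    using A by (intro prod.mono_neutral_right) auto
  also have "\<dots> = (\<Prod>i\<in>A. 1 - (1 - p) * p ^ v)"
  proof (intro prod.cong refl)
    fix i assume "i \<in> A"
    have "measure_pmf.prob (geometric_pmf (1 - p)) (- {v})
        = 1 - measure_pmf.prob (geometric_pmf (1 - p)) {v}"
      using measure_pmf.prob_compl[of "{v}" "geometric_pmf (1 - p)"]
      by (simp add: Compl_eq_Diff_UNIV)
    then show "measure_pmf.prob (geometric_pmf (1 - p)) (?B i) = 1 - (1 - p) * p ^ v"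
      using p \<open>i \<in> A\<close> by (simp add: measure_pmf_single mult.commute)
  qed
  finally show ?thesis by simp
qed

text \<open>
  Picking from each block a position with the required value gives increasing positions. So a
  composition that does not contain the pattern misses the required value throughout some block.
\<close>

lemma contains_exact_pattern_if_blocks:
  assumes blocks: "\<And>j. j < length \<pi> \<Longrightarrow> \<exists>i\<in>{j * m<..Suc j * m}. C i = \<pi> ! j"
    and m: "length \<pi> * m \<le> n"
  shows "contains_exact_pattern n C \<pi>"
proof -
  obtain i where i: "\<And>j. j < length \<pi> \<Longrightarrow> i j \<in> {j * m<..Suc j * m} \<and> C (i j) = \<pi> ! j"
    using blocks by metis
  have "strict_mono_on {..<length \<pi>} i"
  proof (rule strict_mono_onI)
    fix a b assume ab: "a \<in> {..<length \<pi>}" "b \<in> {..<length \<pi>}" "a < b"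
    have "i a \<le> Suc a * m" using i[of a] ab by auto
    also have "\<dots> \<le> b * m" using ab by (intro mult_right_mono) auto
    also have "\<dots> < i b" using i[of b] ab by auto
    finally show "i a < i b" .
  qed
  moreover have "i j \<in> {1..n} \<and> C (i j) = \<pi> ! j" if "j < length \<pi>" for j
  proof -
    have "Suc j * m \<le> length \<pi> * m" using that by (intro mult_right_mono) auto
    with i[OF that] m show ?thesis by auto
  qed
  ultimately show ?thesis unfolding contains_exact_pattern_def by blast
qed

text \<open>
  A union bound over the events that a block misses its entry. Such an event has probability
  \<open>(1 - x) ^ m \<le> exp (- m * x)\<close>, where \<open>x\<close> is the probability of the entry at one position. The block length \<open>m\<close> is kept fixed, so that the error depends on
  \<open>m\<close> only through the expected number of terms equal to \<open>r\<close> in a block.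
\<close>

lemma prob_contains_ge:
  assumes p: "0 \<le> p" "p < 1" and r: "\<And>x. x \<in> set \<pi> \<Longrightarrow> x \<le> r"
    and m: "length \<pi> * m \<le> n"
  shows "measure_pmf.prob (geometric_composition n p) {C. contains_exact_pattern n C \<pi>}
           \<ge> 1 - real (length \<pi>) * exp (- (real m * ((1 - p) * p ^ r)))"
proof -
  let ?M = "geometric_composition n p"
  let ?B = "\<lambda>j. {j * m<..Suc j * m}"
  let ?miss = "\<lambda>j. {C. \<forall>i\<in>?B j. C i \<noteq> \<pi> ! j}"
  have miss: "measure_pmf.prob ?M (?miss j) \<le> exp (- (real m * ((1 - p) * p ^ r)))"
    if j: "j < length \<pi>" for j
  proof -
    let ?x = "(1 - p) * p ^ (\<pi> ! j)"
    have "Suc j * m \<le> length \<pi> * m" using j by (intro mult_right_mono) auto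
    with m have sub: "?B j \<subseteq> {1..n}" by auto
    have x: "?x \<le> 1" using p by (intro mult_le_one power_le_one) auto
    have "measure_pmf.prob ?M (?miss j) = (1 - ?x) ^ m"
      using prob_avoid_value[OF p sub] by simp
    also have "\<dots> \<le> exp (- ?x) ^ m"
      using x exp_ge_add_one_self[of "- ?x"] by (intro power_mono) auto
    also have "\<dots> = exp (- (real m * ?x))"
      by (simp flip: exp_of_nat_mult)
    also have "\<dots> \<le> exp (- (real m * ((1 - p) * p ^ r)))"
    proof -
      have "p ^ r \<le> p ^ (\<pi> ! j)"
        using p r[OF nth_mem[OF j]] by (intro power_decreasing) auto
      then show ?thesis using p by (auto intro!: mult_left_mono)
    qed
    finally show ?thesis .
  qed
  have "- {C. contains_exact_pattern n C \<pi>} \<subseteq> (\<Union>j\<in>{..<length \<pi>}. ?miss j)"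
    using contains_exact_pattern_if_blocks[OF _ m] by blast
  then have "measure_pmf.prob ?M (- {C. contains_exact_pattern n C \<pi>})
      \<le> measure_pmf.prob ?M (\<Union>j\<in>{..<length \<pi>}. ?miss j)"
    by (intro measure_pmf.finite_measure_mono) auto
  also have "\<dots> \<le> (\<Sum>j\<in>{..<length \<pi>}. measure_pmf.prob ?M (?miss j))"
    by (intro measure_pmf.finite_measure_subadditive_finite) auto
  also have "\<dots> \<le> (\<Sum>j\<in>{..<length \<pi>}. exp (- (real m * ((1 - p) * p ^ r))))"
    using miss by (intro sum_mono) auto
  finally show ?thesis
    using measure_pmf.prob_compl[of "{C. contains_exact_pattern n C \<pi>}" ?M]
    by (simp add: Compl_eq_Diff_UNIV)
qed

section \<open>Asymptotics\<close>

lemma much_less_imp_filterlim_at_top: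
  assumes fg: "f \<lless> g" and f: "\<forall>\<^sub>F n in sequentially. f n > 0"
  shows "filterlim (\<lambda>n. g n / f n) at_top sequentially"
proof -
  have "filterlim (\<lambda>n. inverse (f n / g n)) at_top sequentially"
    using fg f unfolding much_less_def
    by (intro filterlim_inverse_at_top) (auto elim: eventually_elim2)
  then show ?thesis by (simp add: field_simps)
qed

lemma power_div_powr_root:
  assumes "r > 0" "n > 0"
  shows "(x / real n powr (- 1 / real r)) ^ r = real n * x ^ r"
proof -
  have "(real n powr (- 1 / real r)) ^ r = inverse (real n)"
    using assms powr_powr[of "real n" "- 1 / real r" "real r"]
      powr_realpow[of "real n powr (- 1 / real r)" r] powr_minus[of "real n" 1]
    by simp
  then show ?thesis by (simp add: power_divide field_simps)
qed

text \<open>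
  No single lower bound works for all \<open>n\<close>, because \<open>p\<close> may oscillate between values near \<open>0\<close> and
  values near \<open>1\<close>. So the comparison is made separately for each \<open>n\<close>: if \<open>p \<le> 1 / 2\<close>, the
  factor \<open>q \<ge> 1 / 2\<close> is harmless and \<open>n * p ^ r\<close> is large; otherwise the factor
  \<open>p ^ r \<ge> (1 / 2) ^ r\<close> is harmless and \<open>n * q\<close> is large.
\<close>

lemma expected_count_at_top:
  fixes p q :: "nat \<Rightarrow> real"
  assumes p: "\<And>n. 0 \<le> p n \<and> p n < 1" and q: "\<And>n. q n = 1 - p n"
    and r: "r > 0"
    and lp: "(\<lambda>n. real n powr (- 1 / real r)) \<lless> p"
    and lq: "(\<lambda>n. real n powr (- 1)) \<lless> q"
  shows "filterlim (\<lambda>n. real n * (q n * p n ^ r)) at_top sequentially"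
proof -
  have pos: "\<forall>\<^sub>F n in sequentially. real n powr a > 0" for a
    using eventually_gt_at_top[of 0] by eventually_elim simp
  have "filterlim (\<lambda>n. (p n / real n powr (- 1 / real r)) ^ r) at_top sequentially"
    using r by (intro filterlim_pow_at_top much_less_imp_filterlim_at_top lp pos)
  then have np: "filterlim (\<lambda>n. real n * p n ^ r) at_top sequentially"
    by (rule filterlim_cong[OF refl refl, THEN iffD1, rotated])
      (use eventually_gt_at_top[of 0] in eventually_elim, rule power_div_powr_root[OF r])
  have "filterlim (\<lambda>n. q n / real n powr (- 1)) at_top sequentially"
    by (intro much_less_imp_filterlim_at_top lq pos)
  then have nq: "filterlim (\<lambda>n. real n * q n) at_top sequentially"
    by (simp add: powr_minus_divide mult.commute)
  show ?thesis unfolding filterlim_at_top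
  proof
    fix Z :: real
    have "\<forall>\<^sub>F n in sequentially. 2 * Z \<le> real n * p n ^ r"
      "\<forall>\<^sub>F n in sequentially. 2 ^ r * Z \<le> real n * q n"
      using np nq by (auto simp: filterlim_at_top)
    then show "\<forall>\<^sub>F n in sequentially. Z \<le> real n * (q n * p n ^ r)"
    proof eventually_elim
      case (elim n)
      show ?case
      proof (cases "p n \<le> 1 / 2")
        case True
        then have "real n * p n ^ r * (1 / 2) \<le> real n * p n ^ r * q n"
          using p[of n] q[of n] by (intro mult_left_mono) auto
        with elim show ?thesis by (simp add: mult_ac)
      next
        case False
        then have "real n * q n * (1 / 2) ^ r \<le> real n * q n * p n ^ r"
          using p[of n] q[of n] by (intro mult_left_mono power_mono) auto
        then have "real n * q n / 2 ^ r \<le> real n * (q n * p n ^ r)"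
          by (simp add: power_one_over mult_ac)
        moreover have "Z \<le> real n * q n / 2 ^ r"
          using elim by (simp add: field_simps)
        ultimately show ?thesis by linarith
      qed
    qed
  qed
qed

theorem proposition4p22:
  fixes p q :: "nat \<Rightarrow> real" and \<pi> :: "nat list" and r :: nat
  assumes p: "\<And>n. 0 \<le> p n \<and> p n < 1"
    and q: "\<And>n. q n = 1 - p n"
    and not_all_zero: "\<exists>x\<in>set \<pi>. x \<noteq> 0"
    and r: "r = Max (set \<pi>)"
  defines "P \<equiv> (\<lambda>n. measure_pmf.prob (geometric_composition n (p n))
                       {C. contains_exact_pattern n C \<pi>})"
  shows "(p \<lless> (\<lambda>n. real n powr (- 1 / real r)) \<longrightarrow> P \<longlonglongrightarrow> 0) \<and>
         ((\<lambda>n. real n powr (- 1 / real r)) \<lless> p \<and> (\<lambda>n. real n powr (- 1)) \<lless> q \<longrightarrow> P \<longlonglongrightarrow> 1) \<and>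
         (q \<lless> (\<lambda>n. real n powr (- 1)) \<longrightarrow> P \<longlonglongrightarrow> 0)"
proof -
  let ?k = "length \<pi>"
  have r_in: "r \<in> set \<pi>" using not_all_zero r by (auto intro!: Max_in)
  have r_ge: "x \<le> r" if "x \<in> set \<pi>" for x using that r by simp
  have r_pos: "r > 0" using not_all_zero r_ge by fastforce
  have k_pos: "?k > 0" using r_in by (cases \<pi>) auto
  have P_nonneg: "0 \<le> P n" and P_le_1: "P n \<le> 1" for n
    by (simp_all add: P_def)
  have pq: "0 \<le> p n" "p n \<le> 1" "0 \<le> q n" "q n \<le> 1" "p n ^ r \<le> 1" for n
    using p[of n] q[of n] by (auto intro!: power_le_one)
  have P_le: "P n \<le> real n * (q n * p n ^ r)" for n
    using prob_contains_le[OF _ _ r_in, of "p n" n] p[of n] by (simp add: P_def q)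
  have P_ge: "1 - real ?k * exp (- (real (n div ?k) * (q n * p n ^ r))) \<le> P n" for n
    using prob_contains_ge[of "p n" \<pi> r "n div ?k" n] p[of n] r_ge by (simp add: P_def q)
  have small_p: "P \<longlonglongrightarrow> 0" if "p \<lless> (\<lambda>n. real n powr (- 1 / real r))"
  proof (rule tendsto_sandwich[OF _ _ tendsto_const])
    have "(\<lambda>n. (p n / real n powr (- 1 / real r)) ^ r) \<longlonglongrightarrow> 0 ^ r"
      using that by (intro tendsto_power) (simp add: much_less_def)
    then show "(\<lambda>n. (p n / real n powr (- 1 / real r)) ^ r) \<longlonglongrightarrow> 0"
      by (simp only: zero_power[OF r_pos])
    show "\<forall>\<^sub>F n in sequentially. P n \<le> (p n / real n powr (- 1 / real r)) ^ r"
      using eventually_gt_at_top[of 0]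
    proof eventually_elim
      case (elim n)
      have "P n \<le> real n * (q n * p n ^ r)" by (rule P_le)
      also have "\<dots> \<le> real n * (1 * p n ^ r)"
        using pq by (intro mult_left_mono mult_right_mono) auto
      finally show ?case using power_div_powr_root[OF r_pos elim] by simp
    qed
  qed (simp add: P_nonneg)
  have small_q: "P \<longlonglongrightarrow> 0" if "q \<lless> (\<lambda>n. real n powr (- 1))"
  proof (rule tendsto_sandwich[OF _ _ tendsto_const])
    show "(\<lambda>n. real n * q n) \<longlonglongrightarrow> 0"
      using that by (simp add: much_less_def powr_minus_divide mult.commute)
    have "P n \<le> real n * q n" for n
    proof -
      have "P n \<le> real n * (q n * p n ^ r)" by (rule P_le)
      also have "\<dots> \<le> real n * (q n * 1)"
        using pq by (intro mult_left_mono) auto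
      finally show ?thesis by simp
    qed
    then show "\<forall>\<^sub>F n in sequentially. P n \<le> real n * q n" by simp
  qed (simp add: P_nonneg)
  have middle: "P \<longlonglongrightarrow> 1"
    if "(\<lambda>n. real n powr (- 1 / real r)) \<lless> p" "(\<lambda>n. real n powr (- 1)) \<lless> q"
  proof (rule tendsto_sandwich[OF _ _ _ tendsto_const])
    \<comment> \<open>Rounding \<open>n / k\<close> down costs less than one position, and \<open>q * p ^ r \<le> 1\<close>.\<close>
    have block: "real n * (q n * p n ^ r) / real ?k - 1 \<le> real (n div ?k) * (q n * p n ^ r)" for n
    proof -
      have "real n / real ?k - 1 \<le> real (n div ?k)"
      proof -
        have "real n \<le> real (?k + ?k * (n div ?k))"
          using dividend_less_times_div[OF k_pos, of n] by (simp only: of_nat_le_iff)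
        then show ?thesis using k_pos by (simp add: field_simps)
      qed
      then have "(real n / real ?k - 1) * (q n * p n ^ r) \<le> real (n div ?k) * (q n * p n ^ r)"
        using pq by (intro mult_right_mono) auto
      moreover have "q n * p n ^ r \<le> 1" using pq by (intro mult_le_one) auto
      ultimately show ?thesis by (simp add: left_diff_distrib)
    qed
    have "filterlim (\<lambda>n. real n * (q n * p n ^ r) * (1 / real ?k)) at_top sequentially"
      using k_pos expected_count_at_top[OF p q r_pos that]
      by (intro filterlim_at_top_mult_tendsto_pos[OF tendsto_const]) auto
    then have "filterlim (\<lambda>n. - 1 + real n * (q n * p n ^ r) * (1 / real ?k)) at_top sequentially"
      by (rule filterlim_tendsto_add_at_top[OF tendsto_const])
    then have "filterlim (\<lambda>n. real (n div ?k) * (q n * p n ^ r)) at_top sequentially"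
      by (rule filterlim_at_top_mono) (use block in \<open>auto simp: algebra_simps\<close>)
    then have "(\<lambda>n. exp (- (real (n div ?k) * (q n * p n ^ r)))) \<longlonglongrightarrow> 0"
      by (intro filterlim_compose[OF exp_at_bot] filterlim_compose[OF filterlim_uminus_at_bot_at_top])
    then have "(\<lambda>n. 1 - real ?k * exp (- (real (n div ?k) * (q n * p n ^ r)))) \<longlonglongrightarrow> 1 - real ?k * 0"
      by (intro tendsto_intros)
    then show "(\<lambda>n. 1 - real ?k * exp (- (real (n div ?k) * (q n * p n ^ r)))) \<longlonglongrightarrow> 1"
      by simp
  qed (use P_ge P_le_1 in auto)
  show ?thesis using small_p small_q middle by blast
qed

end
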